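(* Let $H$ be a hypergraph with weight functions $w_V:V(H)\to(0,\infty)$ and $w_E:E(H)\to(0,\infty)$ and associated Laplacian matrix $L_H$. If $U$ is a linearly dependent set of vertices in $H$, and there is a constant $c_U\in\mathbb{R}$ such that $$w_V(v)\left(\sum_{u\in V(H)}\ \sum_{e\in E_u(H)\cap E_v(H)}w_E(e)\right)=c_U\quad\text{for all }v\in U,$$ then $c_U$ is an eigenvalue of $L_H$.
   Context: A hypergraph $H=(V(H),E(H))$ consists of a finite non-empty vertex set $V(H)$ and a set $E(H)\subseteq\mathcal{P}(V(H))$ of hyperedges. The star of $v$ is $E_v(H)=\{e\in E(H):v\in e\}$. Let $i_{ve}=1$ if $v\in e$ and $0$ otherwise, and $s_v:E(H)\to\{0,1\}$, $s_v(e)=i_{ve}$. A set $U\subseteq V(H)$ is linearly dependent if the family $(s_v)_{v\in U}$ (indexed by $U$) is linearly dependent. The adjacency matrix $A_H=[a_{uv}]_{u,v\in V(H)}$ is defined by $a_{uu}=0$ and, for distinct $u,v$, $a_{uv}=\sum_{e\in E(H)}w_V(u)\,i_{ue}\,i_{ve}\,w_E(e)$. The Laplacian matrix is $L_H=K_H-A_H$, where $K_H$ is the diagonal matrix indexed by $V(H)$ whose $v$-th diagonal entry is the row sum $\sum_{u\in V(H)}a_{vu}$. *)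

theory Defs
  imports Jordan_Normal_Form.Char_Poly
begin

locale hypergraph =
  fixes V :: "'a set" and E :: "'a set set"
  assumes finite_vertices: "finite V"
    and vertices_nonempty: "V \<noteq> {}"
    and edges_subset: "E \<subseteq> Pow V"

definition star :: "'a set set \<Rightarrow> 'a \<Rightarrow> 'a set set" where
  "star E v = {e \<in> E. v \<in> e}"

definition incidence :: "'a \<Rightarrow> 'a set \<Rightarrow> real" where
  "incidence v e = (if v \<in> e then 1 else 0)"

text \<open>Linear dependence over the reals of the family of functions
  \<open>incidence v\<close> on \<open>E\<close>, indexed by \<open>v \<in> U\<close>. This is a notion for families, so two
  distinct vertices with the same star form a dependent set; the library's
  \<open>dependent\<close>, being a notion for sets of vectors, would identify the two.
  It is meant for \<open>U \<subseteq> V\<close>, where \<open>U\<close> is finite.\<close>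

definition lin_dependent_vertices :: "'a set set \<Rightarrow> 'a set \<Rightarrow> bool" where
  "lin_dependent_vertices E U \<longleftrightarrow>
     (\<exists>c :: 'a \<Rightarrow> real. (\<exists>v\<in>U. c v \<noteq> 0) \<and> (\<forall>e\<in>E. (\<Sum>v\<in>U. c v * incidence v e) = 0))"

text \<open>Matrices indexed by the vertex set are functions of two vertices, of which only
  the values on \<open>V\<close> matter.\<close>

definition adjacency ::
  "'a set set \<Rightarrow> ('a \<Rightarrow> real) \<Rightarrow> ('a set \<Rightarrow> real) \<Rightarrow> 'a \<Rightarrow> 'a \<Rightarrow> real" where
  "adjacency E wV wE u v =
     (if u = v then 0 else (\<Sum>e\<in>E. wV u * incidence u e * incidence v e * wE e))"

definition degree_diag ::
  "'a set \<Rightarrow> 'a set set \<Rightarrow> ('a \<Rightarrow> real) \<Rightarrow> ('a set \<Rightarrow> real) \<Rightarrow> 'a \<Rightarrow> 'a \<Rightarrow> real" where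
  "degree_diag V E wV wE u v =
     (if u = v then (\<Sum>x\<in>V. adjacency E wV wE v x) else 0)"

definition laplacian ::
  "'a set \<Rightarrow> 'a set set \<Rightarrow> ('a \<Rightarrow> real) \<Rightarrow> ('a set \<Rightarrow> real) \<Rightarrow> 'a \<Rightarrow> 'a \<Rightarrow> real" where
  "laplacian V E wV wE u v = degree_diag V E wV wE u v - adjacency E wV wE u v"

text \<open>The matrix obtained by listing the index set in the order \<open>vs\<close>. Different
  enumerations of the same set give permutation-similar matrices.\<close>

definition matrix_along :: "'a list \<Rightarrow> ('a \<Rightarrow> 'a \<Rightarrow> real) \<Rightarrow> real mat" where
  "matrix_along vs M = mat (length vs) (length vs) (\<lambda>(i, j). M (vs ! i) (vs ! j))"

end

theory Submission imports Defs begin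

text \<open>
  Two vertices \<open>u\<close>, \<open>v\<close>, equal or not, have the overlap \<open>wV u\<close> times the total weight of their
  common edges. Off the diagonal this is the adjacency matrix. On the diagonal the adjacency matrix
  is zero, but the Laplacian does not see the difference: a diagonal entry added to the adjacency
  matrix also enters the row sum and cancels. Hence the Laplacian is the diagonal matrix of the row
  sums of the overlap matrix, minus the overlap matrix itself (\<open>laplacian_eq_overlap\<close>).

  The overlap matrix factors through the incidence matrix: each of its rows is a linear combination
  of the indicator functions of the edges. It therefore annihilates the coefficient vector of every
  linear dependence between stars (\<open>overlap_annihilates_dependence\<close>). On such a vector, extended
  by zero outside \<open>U\<close>, the Laplacian acts as the diagonal matrix of overlap row sums. These row sums
  are all \<open>c\<close> on \<open>U\<close> by hypothesis, and outside \<open>U\<close> the vector vanishes, so it is an eigenvector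
  for \<open>c\<close>.
\<close>

definition overlap ::
  "'a set set \<Rightarrow> ('a \<Rightarrow> real) \<Rightarrow> ('a set \<Rightarrow> real) \<Rightarrow> 'a \<Rightarrow> 'a \<Rightarrow> real" where
  "overlap E wV wE u v = wV u * (\<Sum>e\<in>star E u \<inter> star E v. wE e)"

lemma overlap_eq_incidence_sum:
  assumes "finite E"
  shows "overlap E wV wE u v = (\<Sum>e\<in>E. wV u * incidence u e * incidence v e * wE e)"
proof -
  have "star E u \<inter> star E v = {e \<in> E. u \<in> e \<and> v \<in> e}"
    by (auto simp: star_def)
  then have "overlap E wV wE u v = (\<Sum>e\<in>E. if u \<in> e \<and> v \<in> e then wV u * wE e else 0)"
    using assms by (simp add: overlap_def sum_distrib_left flip: sum.inter_filter)
  also have "\<dots> = (\<Sum>e\<in>E. wV u * incidence u e * incidence v e * wE e)"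
    by (intro sum.cong) (auto simp: incidence_def)
  finally show ?thesis .
qed

lemma laplacian_eq_overlap:
  assumes "finite V" "finite E" "u \<in> V"
  shows "laplacian V E wV wE u v
    = (if u = v then \<Sum>x\<in>V. overlap E wV wE u x else 0) - overlap E wV wE u v"
proof -
  have adj: "adjacency E wV wE w x = (if w = x then 0 else overlap E wV wE w x)" for w x
    using assms(2) by (simp add: adjacency_def overlap_eq_incidence_sum)
  have "(\<Sum>x\<in>V. adjacency E wV wE u x) = (\<Sum>x\<in>V - {u}. overlap E wV wE u x)"
    using assms(1) by (intro sum.mono_neutral_cong_right) (auto simp: adj)
  also have "\<dots> = (\<Sum>x\<in>V. overlap E wV wE u x) - overlap E wV wE u u"
    using assms(1,3) by (simp add: sum_diff1)
  finally have "(\<Sum>x\<in>V. adjacency E wV wE u x)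
      = (\<Sum>x\<in>V. overlap E wV wE u x) - overlap E wV wE u u" .
  then show ?thesis
    by (auto simp: laplacian_def degree_diag_def adj)
qed

lemma laplacian_apply:
  assumes "finite V" "finite E" "u \<in> V"
  shows "(\<Sum>v\<in>V. laplacian V E wV wE u v * x v)
    = (\<Sum>v\<in>V. overlap E wV wE u v) * x u - (\<Sum>v\<in>V. overlap E wV wE u v * x v)"
proof -
  have "(\<Sum>v\<in>V. laplacian V E wV wE u v * x v)
    = (\<Sum>v\<in>V. (if u = v then (\<Sum>w\<in>V. overlap E wV wE u w) * x v else 0)
        - overlap E wV wE u v * x v)"
    by (intro sum.cong) (auto simp: laplacian_eq_overlap[OF assms] algebra_simps)
  then show ?thesis
    using assms by (simp add: sum_subtractf)
qed

text \<open>Summing over the vertices first exposes, for each edge, the dependence evaluated at that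
  edge.\<close>

lemma overlap_annihilates_dependence:
  assumes "finite E" and "\<forall>e\<in>E. (\<Sum>v\<in>V. x v * incidence v e) = 0"
  shows "(\<Sum>v\<in>V. overlap E wV wE u v * x v) = 0"
proof -
  have "(\<Sum>v\<in>V. overlap E wV wE u v * x v)
      = (\<Sum>v\<in>V. \<Sum>e\<in>E. wV u * incidence u e * wE e * (x v * incidence v e))"
    using assms(1)
    by (simp add: overlap_eq_incidence_sum sum_distrib_left ac_simps)
  also have "\<dots> = (\<Sum>e\<in>E. \<Sum>v\<in>V. wV u * incidence u e * wE e * (x v * incidence v e))"
    by (rule sum.swap)
  also have "\<dots> = (\<Sum>e\<in>E. wV u * incidence u e * wE e * (\<Sum>v\<in>V. x v * incidence v e))"
    by (simp add: sum_distrib_left)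
  finally show ?thesis
    using assms(2) by simp
qed

lemma eigenvalue_matrix_alongI:
  fixes x :: "'a \<Rightarrow> real"
  assumes "distinct vs" and "v \<in> set vs" and "x v \<noteq> 0"
    and eig: "\<And>u. u \<in> set vs \<Longrightarrow> (\<Sum>v\<in>set vs. M u v * x v) = k * x u"
  shows "eigenvalue (matrix_along vs M) k"
proof -
  define n where "n = length vs"
  define y where "y = vec n (\<lambda>i. x (vs ! i))"
  obtain i where "i < n" "vs ! i = v"
    using assms(2) by (auto simp: in_set_conv_nth n_def)
  then have "y $ i \<noteq> 0"
    using assms(3) by (simp add: y_def)
  then have "y \<noteq> 0\<^sub>v n"
    using \<open>i < n\<close> by auto
  moreover have "matrix_along vs M *\<^sub>v y = k \<cdot>\<^sub>v y"
  proof (rule eq_vecI)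
    fix j assume "j < dim_vec (k \<cdot>\<^sub>v y)"
    then have j: "j < n"
      by (simp add: y_def)
    have "(matrix_along vs M *\<^sub>v y) $ j = (\<Sum>i<n. M (vs ! j) (vs ! i) * x (vs ! i))"
      using j by (simp add: matrix_along_def y_def n_def scalar_prod_def lessThan_atLeast0)
    also have "\<dots> = (\<Sum>v\<in>set vs. M (vs ! j) v * x v)"
      using sum.reindex_bij_betw[OF bij_betw_nth[OF assms(1) refl refl]]
      by (simp add: n_def)
    finally show "(matrix_along vs M *\<^sub>v y) $ j = (k \<cdot>\<^sub>v y) $ j"
      using j eig[of "vs ! j"] by (simp add: y_def n_def)
  qed (simp add: matrix_along_def y_def n_def)
  ultimately have "eigenvector (matrix_along vs M) y k"
    by (auto simp: eigenvector_def matrix_along_def y_def n_def)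
  then show ?thesis
    unfolding eigenvalue_def by blast
qed

theorem corollary3p6:
  fixes V :: "'a set" and E :: "'a set set"
    and wV :: "'a \<Rightarrow> real" and wE :: "'a set \<Rightarrow> real"
    and U :: "'a set" and c :: real
  assumes "hypergraph V E"
    and "\<forall>v\<in>V. wV v > 0"
    and "\<forall>e\<in>E. wE e > 0"
    and "U \<subseteq> V"
    and "lin_dependent_vertices E U"
    and "\<forall>v\<in>U. wV v * (\<Sum>u\<in>V. \<Sum>e\<in>star E u \<inter> star E v. wE e) = c"
  shows "\<forall>vs. distinct vs \<and> set vs = V \<longrightarrow>
           eigenvalue (matrix_along vs (laplacian V E wV wE)) c"
proof (intro allI impI, elim conjE)
  fix vs :: "'a list"
  assume vs: "distinct vs" "set vs = V"
  have finV: "finite V" and finE: "finite E"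
    using hypergraph.finite_vertices[OF assms(1)] hypergraph.edges_subset[OF assms(1)]
    by (auto intro: finite_subset)
  obtain d v where d: "v \<in> U" "d v \<noteq> 0" "\<forall>e\<in>E. (\<Sum>v\<in>U. d v * incidence v e) = 0"
    using assms(5) by (auto simp: lin_dependent_vertices_def)
  define x where "x v = (if v \<in> U then d v else 0)" for v
  have "(\<Sum>v\<in>V. x v * incidence v e) = (\<Sum>v\<in>U. d v * incidence v e)" for e
    using finV assms(4) by (intro sum.mono_neutral_cong_right) (auto simp: x_def)
  then have kernel: "(\<Sum>v\<in>V. overlap E wV wE u v * x v) = 0" for u
    using d(3) by (intro overlap_annihilates_dependence[OF finE]) simp
  have row_sum: "(\<Sum>v\<in>V. overlap E wV wE u v) = c" if "u \<in> U" for u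
    using assms(6)[rule_format, OF that]
    by (simp add: overlap_def Int_commute flip: sum_distrib_left)
  show "eigenvalue (matrix_along vs (laplacian V E wV wE)) c"
  proof (rule eigenvalue_matrix_alongI[OF vs(1)])
    show "v \<in> set vs" "x v \<noteq> 0"
      using d(1,2) assms(4) vs(2) by (auto simp: x_def)
    fix u assume "u \<in> set vs"
    then show "(\<Sum>v\<in>set vs. laplacian V E wV wE u v * x v) = c * x u"
      using laplacian_apply[OF finV finE, of u wV wE x] kernel row_sum[of u] vs(2)
      by (cases "u \<in> U") (simp_all add: x_def)
  qed
qed

end
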